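(* Let $A$ be a subtracted image partition regular matrix and let $B$ be a weak Milliken–Taylor matrix. Then the diagonal sum $\begin{pmatrix} A & 0\\ 0 & B\end{pmatrix}$ is image partition regular.
   Context: $\omega=\{0,1,2,\dots\}$, $\mathbb{N}=\{1,2,\dots\}$. For $u,v\in\mathbb{N}\cup\{\omega\}$, a $u\times v$ matrix $A$ with rational entries (each row having only finitely many nonzero entries when $v=\omega$) is image partition regular if whenever $r\in\mathbb{N}$ and $\mathbb{N}=\bigcup_{i=1}^r C_i$, there exist $i\in\{1,\dots,r\}$ and $\vec{x}\in\mathbb{N}^v$ with $A\vec{x}\in C_i^u$. An $\omega\times\omega$ matrix $A$ with entries from $\mathbb{Q}$ is subtracted image partition regular if (1) no row of $A$ is $\vec{0}$; (2) for each $i\in\omega$, $\{j\in\omega:a_{ij}\neq0\}$ is finite; (3) writing $\vec{c_0},\vec{c_1},\dots$ for the columns of $A$, there exist $n\in\omega$ and $k\in\mathbb{N}$ such that the rows of $(\vec{c_n}\ \vec{c_{n+1}}\ \cdots\ \vec{c_{n+k-1}})$ are precisely the rows of a finite image partition regular matrix, and the remaining columns of $A$ form an image partition regular matrix. For a sequence $\vec{r}$ with entries in $\omega$, $d(\vec{r})$ is the sequence obtained by deleting all occurrences of $0$. An $\omega\times\omega$ matrix $B$ with entries from $\omega$ is a weak Milliken–Taylor matrix if each row has only finitely many nonzero entries and there is a finite sequence $\vec{a}\in\omega^m$, $m\in\mathbb{N}$, such that the rows of $B$ are exactly all row vectors $\vec{r}\in\omega^\omega$ with $d(\vec{r})=\vec{a}$.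 Here $0$ in the diagonal sum denotes zero matrices of the appropriate size. *)

theory Defs
  imports Complex_Main
begin

text \<open>
  A matrix is a function of a row index and a column index together with the sets of
  admissible row and column indices: \<open>{..<n}\<close> for a finite dimension \<open>n\<close>, \<open>UNIV :: nat set\<close> for
  the dimension \<open>\<omega>\<close>, and \<open>UNIV :: (nat + nat) set\<close> for the dimension \<open>\<omega> + \<omega>\<close> of a block matrix.
\<close>

definition mat_vec :: "'j set \<Rightarrow> ('i \<Rightarrow> 'j \<Rightarrow> rat) \<Rightarrow> ('j \<Rightarrow> nat) \<Rightarrow> 'i \<Rightarrow> rat" where
  "mat_vec J A x i = (\<Sum>j | j \<in> J \<and> A i j \<noteq> 0. A i j * of_nat (x j))"

definition image_partition_regular :: "'i set \<Rightarrow> 'j set \<Rightarrow> ('i \<Rightarrow> 'j \<Rightarrow> rat) \<Rightarrow> bool" where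
  "image_partition_regular I J A \<longleftrightarrow>
     (\<forall>i\<in>I. finite {j \<in> J. A i j \<noteq> 0}) \<and>
     (\<forall>r\<ge>1. \<forall>C :: nat \<Rightarrow> nat set. (\<Union>c\<in>{1..r}. C c) = {1..} \<longrightarrow>
        (\<exists>c\<in>{1..r}. \<exists>x. (\<forall>j\<in>J. x j \<ge> 1) \<and> (\<forall>i\<in>I. mat_vec J A x i \<in> of_nat ` C c)))"

text \<open>
  The column block is compared with \<open>F\<close> via sets of rows, each row of length \<open>k\<close> being written as a list.  The
  remaining columns keep their original indices, so they form a matrix with column index set
  \<open>UNIV - {n..<n + k}\<close>.
\<close>

definition subtracted_image_partition_regular :: "(nat \<Rightarrow> nat \<Rightarrow> rat) \<Rightarrow> bool" where
  "subtracted_image_partition_regular A \<longleftrightarrow>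
     (\<forall>i. \<exists>j. A i j \<noteq> 0) \<and>
     (\<forall>i. finite {j. A i j \<noteq> 0}) \<and>
     (\<exists>n k. k \<ge> 1 \<and>
        (\<exists>m::nat. m \<ge> 1 \<and> (\<exists>F. image_partition_regular {..<m} {..<k} F \<and>
           range (\<lambda>i. map (A i) [n..<n + k]) = (\<lambda>i. map (F i) [0..<k]) ` {..<m})) \<and>
        image_partition_regular UNIV (UNIV - {n..<n + k}) A)"

text \<open>Meaningful only for sequences with finitely many nonzero entries.\<close>

definition delete_zeros :: "(nat \<Rightarrow> nat) \<Rightarrow> nat list" where
  "delete_zeros r = map r (sorted_list_of_set {j. r j \<noteq> 0})"

definition weak_Milliken_Taylor :: "(nat \<Rightarrow> nat \<Rightarrow> nat) \<Rightarrow> bool" where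
  "weak_Milliken_Taylor B \<longleftrightarrow>
     (\<forall>i. finite {j. B i j \<noteq> 0}) \<and>
     (\<exists>a. length a \<ge> 1 \<and> range B = {r. finite {j. r j \<noteq> 0} \<and> delete_zeros r = a})"

fun diagonal_sum :: "('i \<Rightarrow> 'j \<Rightarrow> rat) \<Rightarrow> ('k \<Rightarrow> 'l \<Rightarrow> rat) \<Rightarrow> 'i + 'k \<Rightarrow> 'j + 'l \<Rightarrow> rat" where
  "diagonal_sum A B (Inl i) (Inl j) = A i j"
| "diagonal_sum A B (Inl i) (Inr j) = 0"
| "diagonal_sum A B (Inr i) (Inl j) = 0"
| "diagonal_sum A B (Inr i) (Inr j) = B i j"

end

theory Submission
  imports Defs "HOL-Library.Nat_Bijection"
begin

text \<open>
  Constant vectors reduce the theorem to \<open>A\<close>: if \<open>B\<close> is generated by \<open>a\<close> and \<open>s\<close> is the sum of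
  the entries of \<open>a\<close>, then \<open>B\<close> maps the constant vector with value \<open>t\<close> to the constant vector
  with value \<open>s * t\<close>. Colouring \<open>t\<close> by the colour of \<open>s * t\<close> and using that \<open>A\<close> is image
  partition regular gives \<open>x\<close> such that \<open>A (s x)\<close> and \<open>s * (A x)\<^sub>0\<close> have the same colour.

  For \<open>A\<close> itself, a compactness argument provides a finite colouring \<open>c\<close> such that for each \<open>N\<close>
  some image \<open>y\<close> of the remaining columns satisfies that \<open>n + y\<^sub>i\<close> has colour \<open>c n\<close> for all \<open>i\<close>
  and all \<open>n < N\<close>. An image of the finite block that is monochromatic for \<open>c\<close> has only finitely
  many entries, hence can be added to such a \<open>y\<close>.
\<close>

text \<open>For the value sets of images of a matrix, this expresses image partition regularity in a
  form that can be localized to subsets \<open>S\<close>. Naming the common colour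
  \<open>f z\<close> with \<open>z\<close> unrestricted keeps it in \<open>range f\<close> even for
  empty \<open>X\<close>.\<close>

definition large :: "nat set set \<Rightarrow> nat set \<Rightarrow> bool" where
  "large \<F> S \<longleftrightarrow>
     (\<forall>f :: nat \<Rightarrow> nat. finite (range f) \<longrightarrow> (\<exists>X\<in>\<F>. X \<subseteq> S \<and> (\<exists>z. \<forall>y\<in>X. f y = f z)))"

text \<open>If every class \<open>c\<close> had a bad colouring \<open>h c\<close>, then colouring
  \<open>y\<close> by the pair of its class and its bad colour within that class would still be
  finite. A set monochromatic for the pairs lies in one class and defeats that class's bad
  colouring.\<close>

lemma large_colour_class:
  fixes f :: "nat \<Rightarrow> nat"
  assumes S: "large \<F> S" and f: "finite (range f)"
  obtains c where "c \<in> range f" "large \<F> {y \<in> S. f y = c}"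
proof -
  have "\<exists>c\<in>range f. large \<F> {y \<in> S. f y = c}"
  proof (rule ccontr)
    assume "\<not> ?thesis"
    then have "\<forall>c\<in>range f. \<not> large \<F> {y \<in> S. f y = c}"
      by simp
    then have "\<forall>c\<in>range f. \<exists>h :: nat \<Rightarrow> nat. finite (range h) \<and>
        \<not> (\<exists>X\<in>\<F>. X \<subseteq> {y \<in> S. f y = c} \<and> (\<exists>z. \<forall>y\<in>X. h y = h z))"
      unfolding large_def not_all not_imp .
    from bchoice[OF this] obtain h :: "nat \<Rightarrow> nat \<Rightarrow> nat"
      where h: "\<forall>c\<in>range f. finite (range (h c)) \<and>
        \<not> (\<exists>X\<in>\<F>. X \<subseteq> {y \<in> S. f y = c} \<and> (\<exists>z. \<forall>y\<in>X. h c y = h c z))"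
      by (elim exE)
    define g where "g y = prod_encode (f y, h (f y) y)" for y
    have "range g \<subseteq> prod_encode ` (SIGMA c:range f. range (h c))"
      by (auto simp: g_def)
    moreover have "finite (prod_encode ` (SIGMA c:range f. range (h c)))"
      by (intro finite_imageI finite_SigmaI f conjunct1[OF bspec[OF h]])
    ultimately have "finite (range g)"
      by (rule finite_subset)
    with S have "\<exists>X\<in>\<F>. X \<subseteq> S \<and> (\<exists>z. \<forall>y\<in>X. g y = g z)"
      unfolding large_def by simp
    then obtain X z where X: "X \<in> \<F>" "X \<subseteq> S" and z: "\<forall>y\<in>X. g y = g z"
      by (elim bexE conjE exE)
    have eq: "f y = f z \<and> h (f z) y = h (f z) z" if "y \<in> X" for y
      using bspec[OF z that] by (auto simp: g_def)
    then have "X \<subseteq> {y \<in> S. f y = f z}" and "\<forall>y\<in>X. h (f z) y = h (f z) z"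
      using X(2) by auto
    then show False
      using conjunct2[OF bspec[OF h rangeI]] X(1) by blast
  qed
  then show thesis
    using that by blast
qed

lemma large_shift_colouring:
  fixes f :: "nat \<Rightarrow> nat"
  assumes L: "large \<F> UNIV" and f: "finite (range f)"
  obtains c where "range c \<subseteq> range f"
    and "\<And>N. \<exists>X\<in>\<F>. \<forall>y\<in>X. \<forall>n<N. f (n + y) = c n"
proof -
  have step: "\<exists>T'. large \<F> T' \<and> T' \<subseteq> T \<and> (\<exists>c\<in>range f. \<forall>y\<in>T'. f (n + y) = c)"
    if T: "large \<F> T" for T n
  proof -
    have sub: "range (\<lambda>y. f (n + y)) \<subseteq> range f"
      by auto
    obtain c where "c \<in> range (\<lambda>y. f (n + y))" "large \<F> {y \<in> T. f (n + y) = c}"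
      using large_colour_class[OF T finite_subset[OF sub f]] by blast
    then show ?thesis
      using sub by (intro exI[of _ "{y \<in> T. f (n + y) = c}"]) auto
  qed
  \<comment> \<open>Starting from a large set, stage \<open>n\<close> keeps a large subset on which
    the colour of \<open>n + y\<close> no longer depends on \<open>y\<close>; that colour becomes
    \<open>c n\<close>.\<close>
  obtain S where S: "\<And>n. large \<F> (S n)"
    and Suc: "\<And>n. S (Suc n) \<subseteq> S n \<and> (\<exists>c\<in>range f. \<forall>y\<in>S (Suc n). f (n + y) = c)"
    using dependent_nat_choice[of "\<lambda>_. large \<F>"
        "\<lambda>n T T'. T' \<subseteq> T \<and> (\<exists>c\<in>range f. \<forall>y\<in>T'. f (n + y) = c)"] L step by blast
  then obtain c where c: "\<And>n. c n \<in> range f" "\<And>n y. y \<in> S (Suc n) \<Longrightarrow> f (n + y) = c n"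
    by metis
  show thesis
  proof
    show "range c \<subseteq> range f"
      using c by auto
    fix N
    \<comment> \<open>Largeness applied to a constant colouring just extracts a member of \<F>
      inside \<open>S N\<close>.\<close>
    have "finite (range (\<lambda>_::nat. 0::nat))"
      by simp
    with S[of N] obtain X where X: "X \<in> \<F>" "X \<subseteq> S N"
      unfolding large_def by metis
    \<comment> \<open>Shift \<open>n\<close> is settled from \<open>S (Suc n)\<close> on, so
      \<open>S N\<close> settles exactly the shifts below \<open>N\<close>.\<close>
    have "S N \<subseteq> S (Suc n)" if "n < N" for n
      using lift_Suc_antimono_le[of S "Suc n" N] Suc that by auto
    then have "\<forall>y\<in>X. \<forall>n<N. f (n + y) = c n"
      using X(2) c(2) by (meson subsetD)
    then show "\<exists>X\<in>\<F>. \<forall>y\<in>X. \<forall>n<N. f (n + y) = c n"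
      using X(1) by (rule bexI)
  qed
qed

lemma image_partition_regular_monochromatic:
  fixes f :: "nat \<Rightarrow> nat"
  assumes A: "image_partition_regular I J A" and f: "finite (range f)"
  shows "\<exists>c x w. (\<forall>j\<in>J. x j \<ge> 1) \<and>
    (\<forall>i\<in>I. mat_vec J A x i = of_nat (w i) \<and> w i \<ge> 1 \<and> f (w i) = c)"
proof -
  obtain r where r: "\<And>n. f n \<le> r"
    using f by (auto simp: finite_nat_set_iff_bounded_le)
  \<comment> \<open>The classes are numbered from 1, hence colour \<open>c - 1\<close>; leaving out
    0 makes them cover exactly the positive integers.\<close>
  define C where "C c = {n. n \<ge> 1 \<and> f n = c - 1}" for c
  have "(\<Union>c\<in>{1..Suc r}. C c) = {1..}"
  proof (intro equalityI subsetI)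
    fix n :: nat assume "n \<in> {1..}"
    then have "n \<in> C (Suc (f n))" "Suc (f n) \<in> {1..Suc r}"
      using r by (auto simp: C_def)
    then show "n \<in> (\<Union>c\<in>{1..Suc r}. C c)"
      by blast
  qed (auto simp: C_def)
  moreover have "\<forall>r\<ge>1. \<forall>C :: nat \<Rightarrow> nat set. (\<Union>c\<in>{1..r}. C c) = {1..} \<longrightarrow>
      (\<exists>c\<in>{1..r}. \<exists>x. (\<forall>j\<in>J. x j \<ge> 1) \<and> (\<forall>i\<in>I. mat_vec J A x i \<in> of_nat ` C c))"
    using A unfolding image_partition_regular_def by (rule conjunct2)
  ultimately have "\<exists>c\<in>{1..Suc r}. \<exists>x. (\<forall>j\<in>J. x j \<ge> 1) \<and> (\<forall>i\<in>I. mat_vec J A x i \<in> of_nat ` C c)"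
    by simp
  then obtain c x where x: "\<forall>j\<in>J. x j \<ge> 1" and c: "\<forall>i\<in>I. mat_vec J A x i \<in> of_nat ` C c"
    by (elim bexE exE conjE)
  from c have "\<forall>i\<in>I. \<exists>n. n \<in> C c \<and> mat_vec J A x i = of_nat n"
    by auto
  then obtain w where w: "\<And>i. i \<in> I \<Longrightarrow> w i \<in> C c \<and> mat_vec J A x i = of_nat (w i)"
    by metis
  show ?thesis
    using x w by (intro exI[of _ "c - 1"] exI[of _ x] exI[of _ w]) (auto simp: C_def)
qed

lemma image_partition_regularI:
  fixes A :: "'i \<Rightarrow> 'j \<Rightarrow> rat"
  assumes "I \<noteq> {}" and "\<And>i. i \<in> I \<Longrightarrow> finite {j \<in> J. A i j \<noteq> 0}"
    and mono: "\<And>f :: nat \<Rightarrow> nat. finite (range f) \<Longrightarrow> \<exists>c x. (\<forall>j\<in>J. x j \<ge> 1) \<and>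
      (\<forall>i\<in>I. \<exists>n\<ge>1. mat_vec J A x i = of_nat n \<and> f n = c)"
  shows "image_partition_regular I J A"
  unfolding image_partition_regular_def
proof (intro conjI ballI allI impI)
  fix r and C :: "nat \<Rightarrow> nat set"
  assume r: "r \<ge> 1" and C: "(\<Union>c\<in>{1..r}. C c) = {1..}"
  \<comment> \<open>The number 0 lies in no class but still receives a value in
    \<open>{1..r}\<close>, so that \<open>f\<close> is total with finite range.\<close>
  have "\<exists>c. c \<in> {1..r} \<and> (n \<ge> 1 \<longrightarrow> n \<in> C c)" for n
  proof (cases "n \<ge> 1")
    case True
    then have "n \<in> (\<Union>c\<in>{1..r}. C c)"
      using C by simp
    then show ?thesis
      by blast
  qed (use r in auto)
  then obtain f where f: "\<And>n. f n \<in> {1..r}" "\<And>n. n \<ge> 1 \<Longrightarrow> n \<in> C (f n)"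
    by metis
  have "range f \<subseteq> {1..r}"
    using f(1) by (rule image_subsetI)
  then have "finite (range f)"
    by (rule finite_subset) simp
  from mono[OF this] obtain c x where x: "\<forall>j\<in>J. x j \<ge> 1"
    and c: "\<forall>i\<in>I. \<exists>n\<ge>1. mat_vec J A x i = of_nat n \<and> f n = c"
    by blast
  \<comment> \<open>Any row exhibits \<open>c\<close> as a value of \<open>f\<close>; without rows
    \<open>c\<close> could be arbitrary.\<close>
  have "c \<in> {1..r}"
    using \<open>I \<noteq> {}\<close> c f(1) by blast
  moreover have "\<forall>i\<in>I. mat_vec J A x i \<in> of_nat ` C c"
    using c f(2) by blast
  ultimately show "\<exists>c\<in>{1..r}. \<exists>x. (\<forall>j\<in>J. x j \<ge> 1) \<and> (\<forall>i\<in>I. mat_vec J A x i \<in> of_nat ` C c)"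
    using x by blast
qed (use assms in auto)

lemma mat_vec_scale: "mat_vec J A (\<lambda>j. s * x j) i = of_nat s * mat_vec J A x i"
  by (simp add: mat_vec_def sum_distrib_left algebra_simps)

text \<open>The finite support of the row splits at the column block. Indices in the block shift by
  \<open>n\<close> to those of \<open>F\<close>, with equal entries and hence corresponding
  supports; the other columns keep their indices.\<close>

lemma mat_vec_column_block:
  fixes A :: "'i \<Rightarrow> nat \<Rightarrow> rat"
  assumes fin: "finite {j. A i j \<noteq> 0}" and F: "\<And>j. j < k \<Longrightarrow> A i (n + j) = F i' j"
  shows "mat_vec UNIV A (\<lambda>j. if j \<in> {n..<n + k} then x (j - n) else y j) i =
    mat_vec {..<k} F x i' + mat_vec (UNIV - {n..<n + k}) A y i"
proof -
  let ?z = "\<lambda>j. if j \<in> {n..<n + k} then x (j - n) else y j"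
  let ?S = "{j. A i j \<noteq> 0}"
  have "mat_vec UNIV A ?z i = (\<Sum>j\<in>?S \<inter> {n..<n + k}. A i j * of_nat (?z j)) +
      (\<Sum>j\<in>?S - {n..<n + k}. A i j * of_nat (?z j))"
    by (simp only: mat_vec_def UNIV_I simp_thms sum.Int_Diff[OF fin])
  also have "(\<Sum>j\<in>?S \<inter> {n..<n + k}. A i j * of_nat (?z j)) = mat_vec {..<k} F x i'"
    unfolding mat_vec_def
    by (rule sum.reindex_bij_witness[of _ "\<lambda>j. n + j" "\<lambda>j. j - n"])
      (auto simp: F[symmetric])
  also have "(\<Sum>j\<in>?S - {n..<n + k}. A i j * of_nat (?z j)) =
      mat_vec (UNIV - {n..<n + k}) A y i"
    unfolding mat_vec_def by (rule sum.cong) auto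
  finally show ?thesis .
qed

lemma support_diagonal_sum_Inl: "{j. diagonal_sum A B (Inl i) j \<noteq> 0} = Inl ` {j. A i j \<noteq> 0}"
proof (rule set_eqI)
  show "j \<in> {j. diagonal_sum A B (Inl i) j \<noteq> 0} \<longleftrightarrow> j \<in> Inl ` {j. A i j \<noteq> 0}" for j
    by (cases j) auto
qed

lemma support_diagonal_sum_Inr: "{j. diagonal_sum A B (Inr i) j \<noteq> 0} = Inr ` {j. B i j \<noteq> 0}"
proof (rule set_eqI)
  show "j \<in> {j. diagonal_sum A B (Inr i) j \<noteq> 0} \<longleftrightarrow> j \<in> Inr ` {j. B i j \<noteq> 0}" for j
    by (cases j) auto
qed

lemma mat_vec_diagonal_sum_Inl:
  "mat_vec UNIV (diagonal_sum A B) z (Inl i) = mat_vec UNIV A (z \<circ> Inl) i"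
  by (simp add: mat_vec_def support_diagonal_sum_Inl sum.reindex)

lemma mat_vec_diagonal_sum_Inr:
  "mat_vec UNIV (diagonal_sum A B) z (Inr i) = mat_vec UNIV B (z \<circ> Inr) i"
  by (simp add: mat_vec_def support_diagonal_sum_Inr sum.reindex)

lemma finite_diagonal_sum_row:
  assumes "\<And>i. finite {j. A i j \<noteq> 0}" and "\<And>i. finite {j. B i j \<noteq> 0}"
  shows "finite {j. diagonal_sum A B i j \<noteq> 0}"
  using assms by (cases i) (simp_all add: support_diagonal_sum_Inl support_diagonal_sum_Inr)

lemma subtracted_imp_image_partition_regular:
  assumes "subtracted_image_partition_regular A"
  shows "image_partition_regular UNIV UNIV A"
proof -
  obtain n k m F where fin: "\<And>i. finite {j. A i j \<noteq> 0}"
    and F: "image_partition_regular {..<m} {..<k} F"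
    and rows: "range (\<lambda>i. map (A i) [n..<n + k]) = (\<lambda>i. map (F i) [0..<k]) ` {..<m::nat}"
    and A': "image_partition_regular UNIV (UNIV - {n..<n + k}) A"
    using assms unfolding subtracted_image_partition_regular_def by blast
  have "\<exists>i'<m. \<forall>j<k. A i (n + j) = F i' j" for i
  proof -
    have "map (A i) [n..<n + k] \<in> (\<lambda>i. map (F i) [0..<k]) ` {..<m}"
      unfolding rows[symmetric] by (rule rangeI)
    then obtain i' where "i' < m" and eq: "map (A i) [n..<n + k] = map (F i') [0..<k]"
      by auto
    moreover have "A i (n + j) = F i' j" if "j < k" for j
      using arg_cong[OF eq, of "\<lambda>l. l ! j"] that by simp
    ultimately show ?thesis
      by blast
  qed
  \<comment> \<open>Each of the infinitely many rows of \<open>A\<close> is assigned a matching row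
    of the finite matrix \<open>F\<close>, so the block contributes only finitely many distinct
    values.\<close>
  then obtain \<rho> where \<rho>: "\<And>i. \<rho> i < m" "\<And>i j. j < k \<Longrightarrow> A i (n + j) = F (\<rho> i) j"
    by metis
  define \<F> where "\<F> = {range w | w y. (\<forall>j\<in>UNIV - {n..<n + k}. y j \<ge> 1) \<and>
    (\<forall>i. mat_vec (UNIV - {n..<n + k}) A y i = of_nat (w i))}"
  have large: "large \<F> UNIV"
    unfolding large_def
  proof (intro allI impI)
    fix f :: "nat \<Rightarrow> nat" assume "finite (range f)"
    from image_partition_regular_monochromatic[OF A' this] obtain c y w
      where y: "\<forall>j\<in>UNIV - {n..<n + k}. y j \<ge> 1"
        and w: "\<forall>i\<in>UNIV. mat_vec (UNIV - {n..<n + k}) A y i = of_nat (w i) \<and>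
          w i \<ge> 1 \<and> f (w i) = c"
      by (elim exE conjE)
    have "range w \<in> \<F>"
      unfolding \<F>_def using y w by blast
    moreover have "\<forall>y\<in>range w. f y = f (w 0)"
      using w by simp
    ultimately show "\<exists>X\<in>\<F>. X \<subseteq> UNIV \<and> (\<exists>z. \<forall>y\<in>X. f y = f z)"
      by blast
  qed
  show ?thesis
  proof (rule image_partition_regularI)
    fix f :: "nat \<Rightarrow> nat" assume f: "finite (range f)"
    obtain c where c: "range c \<subseteq> range f"
      and shift: "\<And>N. \<exists>X\<in>\<F>. \<forall>y\<in>X. \<forall>n<N. f (n + y) = c n"
      using large_shift_colouring[OF large f] by blast
    from image_partition_regular_monochromatic[OF F finite_subset[OF c f]] obtain d x v
      where x: "\<forall>j\<in>{..<k}. x j \<ge> 1"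
        and "\<forall>i\<in>{..<m}. mat_vec {..<k} F x i = of_nat (v i) \<and> v i \<ge> 1 \<and> c (v i) = d"
      by (elim exE conjE)
    then have v: "mat_vec {..<k} F x i = of_nat (v i) \<and> v i \<ge> 1 \<and> c (v i) = d" if "i < m" for i
      using that by simp
    \<comment> \<open>The colouring \<open>c\<close> was fixed before \<open>N\<close> and works for
      every \<open>N\<close>, so the bound may depend on \<open>v\<close>, which in turn depends on
      \<open>c\<close>.\<close>
    obtain N where N: "\<And>i. i < m \<Longrightarrow> v i < N"
      using finite_nat_set_iff_bounded[of "v ` {..<m}"] by auto
    obtain X where "X \<in> \<F>" and X: "\<And>y n. \<lbrakk>y \<in> X; n < N\<rbrakk> \<Longrightarrow> f (n + y) = c n"
      using shift[of N] by blast
    then obtain w y where y: "\<And>j. j \<notin> {n..<n + k} \<Longrightarrow> y j \<ge> 1"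
      and w: "\<And>i. mat_vec (UNIV - {n..<n + k}) A y i = of_nat (w i)" and Xw: "X = range w"
      unfolding \<F>_def by blast
    let ?z = "\<lambda>j. if j \<in> {n..<n + k} then x (j - n) else y j"
    have mono: "\<exists>t\<ge>1. mat_vec UNIV A ?z i = of_nat t \<and> f t = d" for i
    proof (intro exI[of _ "v (\<rho> i) + w i"] conjI)
      show "mat_vec UNIV A ?z i = of_nat (v (\<rho> i) + w i)"
        using mat_vec_column_block[of A i k n F "\<rho> i" x y, OF fin \<rho>(2)]
          v[OF \<rho>(1), of i] w[of i] by simp
      \<comment> \<open>The shift \<open>v (\<rho> i)\<close> is below \<open>N\<close> and
        \<open>w i\<close> lies in \<open>X\<close>, so the colour is
        \<open>c (v (\<rho> i))\<close>, which is \<open>d\<close> for every row.\<close>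
      show "f (v (\<rho> i) + w i) = d"
        using X[OF _ N[OF \<rho>(1)]] v[OF \<rho>(1)] by (simp add: Xw)
      show "1 \<le> v (\<rho> i) + w i"
        using v[OF \<rho>(1), of i] by simp
    qed
    have z: "?z j \<ge> 1" for j
      using x y[of j] by auto
    show "\<exists>c x. (\<forall>j\<in>UNIV. x j \<ge> 1) \<and>
        (\<forall>i\<in>UNIV. \<exists>t\<ge>1. mat_vec UNIV A x i = of_nat t \<and> f t = c)"
      by (rule exI[of _ d], rule exI[of _ ?z], intro conjI ballI z mono)
  qed (use fin in auto)
qed

lemma sum_list_delete_zeros:
  assumes "finite {j. r j \<noteq> 0}"
  shows "sum_list (delete_zeros r) = (\<Sum>j | r j \<noteq> 0. r j)"
  using assms by (simp add: delete_zeros_def sum_list_distinct_conv_sum_set)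

lemma weak_Milliken_Taylor_constant_vector:
  assumes "weak_Milliken_Taylor B"
  obtains s where "s \<ge> 1"
    and "\<And>t i. mat_vec UNIV (\<lambda>i j. of_nat (B i j)) (\<lambda>_. t) i = of_nat (s * t)"
proof -
  obtain a where "length a \<ge> 1" and fin: "\<And>i. finite {j. B i j \<noteq> 0}"
    and "range B = {r. finite {j. r j \<noteq> 0} \<and> delete_zeros r = a}"
    using assms unfolding weak_Milliken_Taylor_def by blast
  then have a: "delete_zeros (B i) = a" for i
    by (metis (mono_tags, lifting) mem_Collect_eq rangeI)
  show thesis
  proof
    \<comment> \<open>Being what remains of a row after deletion of zeros, \<open>a\<close> has only
      positive entries, which makes the scaling factor positive.\<close>
    have "\<forall>e\<in>set a. e \<noteq> 0"
      using fin[of 0] by (auto simp: a[of 0, symmetric] delete_zeros_def)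
    moreover have "a \<noteq> []"
      using \<open>length a \<ge> 1\<close> by auto
    ultimately show "sum_list a \<ge> 1"
      by (cases a) auto
    fix t i
    show "mat_vec UNIV (\<lambda>i j. of_nat (B i j)) (\<lambda>_. t) i = of_nat (sum_list a * t)"
      using sum_list_delete_zeros[OF fin[of i]] a[of i]
      by (simp add: mat_vec_def sum_distrib_right)
  qed
qed

theorem theorem3p4:
  fixes A :: "nat \<Rightarrow> nat \<Rightarrow> rat" and B :: "nat \<Rightarrow> nat \<Rightarrow> nat"
  assumes "subtracted_image_partition_regular A"
    and "weak_Milliken_Taylor B"
  shows "image_partition_regular UNIV UNIV (diagonal_sum A (\<lambda>i j. of_nat (B i j)))"
proof (rule image_partition_regularI)
  have A: "image_partition_regular UNIV UNIV A"
    using assms(1) by (rule subtracted_imp_image_partition_regular)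
  let ?D = "diagonal_sum A (\<lambda>i j. of_nat (B i j))"
  show "finite {j \<in> UNIV. ?D i j \<noteq> 0}" for i
    using finite_diagonal_sum_row[of A "\<lambda>i j. of_nat (B i j)"] assms
    by (simp add: subtracted_image_partition_regular_def weak_Milliken_Taylor_def)
  obtain s where s: "s \<ge> 1"
    and B: "\<And>t i. mat_vec UNIV (\<lambda>i j. of_nat (B i j)) (\<lambda>_. t) i = of_nat (s * t)"
    using weak_Milliken_Taylor_constant_vector[OF assms(2)] by blast
  fix f :: "nat \<Rightarrow> nat" assume "finite (range f)"
  then have "finite (range (\<lambda>n. f (s * n)))"
    by (rule finite_subset[rotated]) auto
  from image_partition_regular_monochromatic[OF A this] obtain c x w
    where x: "\<forall>j\<in>UNIV. x j \<ge> 1"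
      and "\<forall>i\<in>UNIV. mat_vec UNIV A x i = of_nat (w i) \<and> w i \<ge> 1 \<and> f (s * w i) = c"
    by (elim exE conjE)
  then have w: "mat_vec UNIV A x i = of_nat (w i)" "w i \<ge> 1" "f (s * w i) = c" for i
    by simp_all
  \<comment> \<open>The choice of row 0 is arbitrary: every \<open>s * w i\<close> has colour
    \<open>c\<close>, and the constant \<open>w 0\<close> makes all rows of the lower block equal to
    one of these values.\<close>
  define z where "z = case_sum (\<lambda>j. s * x j) (\<lambda>_::nat. w 0)"
  have pos: "s * p \<ge> 1" if "p \<ge> 1" for p
    using s that by simp
  have z: "z j \<ge> 1" for j
    using pos[OF bspec[OF x UNIV_I]] w(2) by (cases j) (auto simp: z_def)
  have mono: "\<exists>n\<ge>1. mat_vec UNIV ?D z i = of_nat n \<and> f n = c" for i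
  proof (cases i)
    case (Inl i')
    have "z \<circ> Inl = (\<lambda>j. s * x j)"
      by (auto simp: z_def)
    then show ?thesis
      using pos[OF w(2)] w
      by (intro exI[of _ "s * w i'"]) (simp add: Inl mat_vec_diagonal_sum_Inl mat_vec_scale)
  next
    case (Inr i')
    have "z \<circ> Inr = (\<lambda>_. w 0)"
      by (auto simp: z_def)
    then show ?thesis
      using pos[OF w(2)] w B
      by (intro exI[of _ "s * w 0"]) (simp add: Inr mat_vec_diagonal_sum_Inr)
  qed
  show "\<exists>c x. (\<forall>j\<in>UNIV. x j \<ge> 1) \<and>
      (\<forall>i\<in>UNIV. \<exists>n\<ge>1. mat_vec UNIV ?D x i = of_nat n \<and> f n = c)"
    by (rule exI[of _ c], rule exI[of _ z], intro conjI ballI z mono)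
qed simp

end
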